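(* Let $(s_n)_{n\ge0}$ and $(t_n)_{n\ge0}$ be sequences of real numbers with $t_n\ne0$ for all $n$, and let $\alpha,\beta,\gamma$ be indeterminates. For an integer $r\ge0$ define polynomials $f^{(r)}_n(\alpha)$ by $f^{(r)}_{-1}(\alpha)=0$, $f^{(r)}_0(\alpha)=1$, $f^{(r)}_n(\alpha)=(\alpha+s_{n-1+r})f^{(r)}_{n-1}(\alpha)-t_{n-2+r}f^{(r)}_{n-2}(\alpha)$ for $n\ge1$, and write $f_n=f^{(0)}_n$. Define $m(n,k)$ by $m(0,k)=[k=0]$, $m(n,k)=0$ for $k<0$, $m(n,k)=m(n-1,k-1)+s_km(n-1,k)+t_km(n-1,k+1)$ for $n\ge1,k\ge0$, and set $m_n=m(n,0)$. Then for all positive integers $n$, $$\frac{\det\left(\alpha\beta\gamma m_{i+j}+(\alpha\beta+\beta\gamma+\gamma\alpha)m_{i+j+1}+(\alpha+\beta+\gamma)m_{i+j+2}+m_{i+j+3}\right)_{i,j=0}^{n-1}}{\det\left(m_{i+j}\right)_{i,j=0}^{n-1}}$$ $$=\sum_{0\le k\le j\le n}f_j(\alpha)f_k(\beta)f_k(\gamma)\,f^{(j+1)}_{n-j}(\beta)\prod_{\ell=k}^{n-1}t_\ell+\sum_{0\le j<k\le n}f_j(\alpha)f_j(\beta)f_k(\gamma)\,f^{(k+1)}_{n-k}(\beta)\prod_{\ell=j}^{n-1}t_\ell .$$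
   Context: $[\mathcal A]$ is the Iverson bracket. Thus $f^{(r)}_n$ is obtained from $f_n$ by replacing each $s_l$ by $s_{l+r}$ and each $t_l$ by $t_{l+r}$. *)

theory Defs
  imports
    "HOL-Computational_Algebra.Polynomial_Factorial"
    "Jordan_Normal_Form.Determinant"
begin

text \<open>
  The recurrence starts from \<open>f\<^sub>-\<^sub>1 = 0\<close> and \<open>f\<^sub>0 = 1\<close>. Since \<open>f\<^sub>-\<^sub>1\<close> only ever enters
  with value zero (in the step \<open>n = 1\<close>), that index is eliminated and
  \<open>f\<^sub>1 = x + s\<^sub>r\<close> becomes an initial value.
\<close>

fun fpoly :: "(nat \<Rightarrow> real) \<Rightarrow> (nat \<Rightarrow> real) \<Rightarrow> nat \<Rightarrow> nat \<Rightarrow> real poly" where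
  "fpoly s t r 0 = 1"
| "fpoly s t r (Suc 0) = [:s r, 1:]"
| "fpoly s t r (Suc (Suc n)) =
     [:s (Suc n + r), 1:] * fpoly s t r (Suc n) - smult (t (n + r)) (fpoly s t r n)"

text \<open>The term with second index \<open>k - 1\<close> is absent for \<open>k = 0\<close>, as \<open>m(n, -1) = 0\<close>.\<close>

fun moment2 :: "(nat \<Rightarrow> real) \<Rightarrow> (nat \<Rightarrow> real) \<Rightarrow> nat \<Rightarrow> nat \<Rightarrow> real" where
  "moment2 s t 0 k = of_bool (k = 0)"
| "moment2 s t (Suc n) k =
     (if k = 0 then 0 else moment2 s t n (k - 1))
       + s k * moment2 s t n k + t k * moment2 s t n (Suc k)"

definition moment :: "(nat \<Rightarrow> real) \<Rightarrow> (nat \<Rightarrow> real) \<Rightarrow> nat \<Rightarrow> real" where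
  "moment s t n = moment2 s t n 0"

text \<open>
  The identity lives in the field of rational functions over the reals in three
  indeterminates, i.e. the fraction field of \<open>\<real>[\<alpha>][\<beta>][\<gamma>]\<close>: the innermost polynomial
  variable is \<open>\<alpha>\<close>, the outermost one is \<open>\<gamma>\<close>.
\<close>

type_synonym ratfun3 = "real poly poly poly fract"

definition const3 :: "real \<Rightarrow> ratfun3" where
  "const3 c = to_fract [:[:[:c:]:]:]"

definition ind_alpha :: ratfun3 ("\<alpha>") where
  "\<alpha> = to_fract [:[:[:0, 1:]:]:]"

definition ind_beta :: ratfun3 ("\<beta>") where
  "\<beta> = to_fract [:[:0, 1:]:]"

definition ind_gamma :: ratfun3 ("\<gamma>") where
  "\<gamma> = to_fract [:0, 1:]"

definition fpoly_at ::
    "(nat \<Rightarrow> real) \<Rightarrow> (nat \<Rightarrow> real) \<Rightarrow> nat \<Rightarrow> nat \<Rightarrow> ratfun3 \<Rightarrow> ratfun3" where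
  "fpoly_at s t r n x = poly (map_poly const3 (fpoly s t r n)) x"

end

theory Submission
  imports Defs
begin

text \<open>
  Let \<open>T\<close> be the tridiagonal matrix with ones above, \<open>s\<^sub>k\<close> on and \<open>t\<^sub>k\<close> below the diagonal,
  let \<open>M\<close> be the unitriangular matrix of the numbers \<open>m(n, k)\<close>, and let \<open>D\<close> be the diagonal
  matrix of the products \<open>t\<^sub>0 \<dots> t\<^sub>k\<^sub>-\<^sub>1\<close>. The Hankel matrix of the moments is \<open>M D M\<^sup>T\<close>, and
  multiplying \<open>M\<close> by \<open>T\<close> from the right shifts the rows of \<open>M\<close>. Hence the quotient is the
  determinant of the \<open>n \<times> n\<close> truncation of \<open>(\<alpha> + T)(\<beta> + T)(\<gamma> + T)\<close>, which is \<open>A B C\<close> with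
  \<open>A\<close>, \<open>B\<close>, \<open>C\<close> truncated to the formats \<open>n \<times> (n + 1)\<close>, \<open>(n + 1) \<times> (n + 1)\<close>, \<open>(n + 1) \<times> n\<close>.

  The Cauchy--Binet expansion of this determinant is replaced by kernel vectors. The vector
  \<open>x\<^sub>j = (-1)\<^sup>j f\<^sub>j(\<alpha>)\<close> satisfies \<open>A x = 0\<close>, the row vector
  \<open>z\<^sub>k = (-1)\<^sup>k f\<^sub>k(\<gamma>) t\<^sub>k \<dots> t\<^sub>n\<^sub>-\<^sub>1\<close> satisfies \<open>z C = 0\<close>, and \<open>B\<close> has an explicit adjugate \<open>G\<close>
  with \<open>B G = det B\<close>. Bordering \<open>A\<close> with the first unit vector and \<open>C\<close> with \<open>G x\<close> yields
  \<open>det (A B C) = z G x\<close>, the asserted sum.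
\<close>

section \<open>Continuants, the tridiagonal determinant and its adjugate\<close>

text \<open>The polynomials of the theorem evaluated over any commutative ring, so that the same
  facts serve in the field of rational functions and in polynomial rings.\<close>

fun opoly :: "(nat \<Rightarrow> 'a :: comm_ring_1) \<Rightarrow> (nat \<Rightarrow> 'a) \<Rightarrow> nat \<Rightarrow> nat \<Rightarrow> 'a \<Rightarrow> 'a" where
  "opoly s t r 0 x = 1"
| "opoly s t r (Suc 0) x = x + s r"
| "opoly s t r (Suc (Suc n)) x =
     (x + s (Suc n + r)) * opoly s t r (Suc n) x - t (n + r) * opoly s t r n x"

text \<open>Continuant splitting: the tridiagonal determinant is cut after its first
  \<open>Suc j\<close> rows, and the second term accounts for the two off-diagonal entries across
  the cut. In \<open>m\<close>, all three values obey one recurrence with the same coefficients, so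
  two initial cases suffice.\<close>

lemma opoly_split:
  "opoly s t r (Suc j + Suc m) x =
     opoly s t r (Suc j) x * opoly s t (Suc (r + j)) (Suc m) x
     - t (r + j) * opoly s t r j x * opoly s t (Suc (Suc (r + j))) m x"
proof (induction m rule: induct_nat_012)
  case 0
  show ?case by (simp add: algebra_simps)
next
  case 1
  show ?case by (simp add: algebra_simps)
next
  case (ge2 m)
  have e1: "opoly s t r (Suc j + Suc (Suc (Suc m))) x =
      (x + s (Suc (Suc (Suc (j + m))) + r)) * opoly s t r (Suc j + Suc (Suc m)) x
      - t (Suc (Suc (j + m)) + r) * opoly s t r (Suc j + Suc m) x"
    by simp
  have e2: "opoly s t (Suc (r + j)) (Suc (Suc (Suc m))) x =
      (x + s (Suc (Suc (Suc (j + m))) + r)) * opoly s t (Suc (r + j)) (Suc (Suc m)) x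
      - t (Suc (Suc (j + m)) + r) * opoly s t (Suc (r + j)) (Suc m) x"
    by (simp add: add_ac)
  have e3: "opoly s t (Suc (Suc (r + j))) (Suc (Suc m)) x =
      (x + s (Suc (Suc (Suc (j + m))) + r)) * opoly s t (Suc (Suc (r + j))) (Suc m) x
      - t (Suc (Suc (j + m)) + r) * opoly s t (Suc (Suc (r + j))) m x"
    by (simp add: add_ac)
  show ?case
    unfolding e1 e2 e3 ge2.IH by (simp only: algebra_simps)
qed

definition jac :: "(nat \<Rightarrow> 'a :: comm_ring_1) \<Rightarrow> (nat \<Rightarrow> 'a) \<Rightarrow> 'a \<Rightarrow> nat \<Rightarrow> nat \<Rightarrow> 'a" where
  "jac s t x i k = (if k = Suc i then 1 else if k = i then x + s i
     else if i = Suc k then t k else 0)"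

lemma sum_jac_row:
  assumes "i < N"
  shows "(\<Sum>k = 0..<N. jac s t x i k * v k) =
    (if i = 0 then 0 else t (i - 1) * v (i - 1)) + (x + s i) * v i
    + (if Suc i < N then v (Suc i) else 0)"
proof -
  \<comment> \<open>For \<open>i = 0\<close> the truncated \<open>i - 1\<close> would match
    \<open>k = 0\<close>; the inner conditional removes that spurious term.\<close>
  have "jac s t x i k * v k = (if i - 1 = k then (if i = 0 then 0 else t k * v k) else 0)
      + (if i = k then (x + s i) * v k else 0) + (if Suc i = k then v k else 0)" for k
    by (auto simp: jac_def)
  then show ?thesis
    using assms by (simp add: sum.distrib)
qed

lemma sum_jac_col:
  assumes "j < N"
  shows "(\<Sum>k = 0..<N. v k * jac s t x k j) =
    (if j = 0 then 0 else v (j - 1)) + v j * (x + s j)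
    + (if Suc j < N then v (Suc j) * t j else 0)"
proof -
  have "v k * jac s t x k j = (if j - 1 = k then (if j = 0 then 0 else v k) else 0)
      + (if j = k then v k * (x + s j) else 0) + (if Suc j = k then v k * t j else 0)" for k
    by (auto simp: jac_def)
  then show ?thesis
    using assms by (simp add: sum.distrib)
qed

text \<open>The vector \<open>v\<close> satisfies every row of \<open>(x + T) v = 0\<close>; after
  truncation only the last row leaves a remainder, \<open>c\<close>. Replacing the first column by
  the matrix times \<open>v\<close> keeps the determinant because \<open>v 0 = 1\<close>, and
  expansion along that column leaves a single minor.\<close>

lemma det_tridiagonal:
  "det (mat (Suc n) (Suc n) (\<lambda>(i, k). jac s t x i k)) = opoly s t 0 (Suc n) x"
proof -
  let ?B = "mat (Suc n) (Suc n) (\<lambda>(i, k). jac s t x i k)"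
  define v where "v k = (-1) ^ k * opoly s t 0 k x" for k
  let ?U = "mat (Suc n) (Suc n) (\<lambda>(i, k). if k = 0 then v i else if i = k then 1 else 0)"
  define c where "c = (-1) ^ n * opoly s t 0 (Suc n) x"
  let ?R = "mat (Suc n) (Suc n) (\<lambda>(i, k). if k = 0 then if i = n then c else 0 else jac s t x i k)"
  have "det ?U = prod_list (diag_mat ?U)"
    by (rule det_lower_triangular[where n = "Suc n"]) auto
  also have "\<dots> = 1"
    by (auto simp: prod_list_diag_prod v_def intro!: prod.neutral)
  finally have U: "det ?U = 1" .
  have v: "(if i = 0 then 0 else t (i - 1) * v (i - 1)) + (x + s i) * v i + v (Suc i) = 0" for i
    by (cases i) (auto simp: v_def algebra_simps)
  have "?B * ?U = ?R"
  proof (rule eq_matI)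
    fix i k assume "i < dim_row ?R" "k < dim_col ?R"
    then have ik: "i < Suc n" "k < Suc n" by auto
    have eq: "(?B * ?U) $$ (i, k) =
      (\<Sum>l = 0..<Suc n. jac s t x i l * (if k = 0 then v l else if l = k then 1 else 0))"
      using ik by (simp add: scalar_prod_def)
    show "(?B * ?U) $$ (i, k) = ?R $$ (i, k)"
    proof (cases "k = 0")
      case True
      have "c = - v (Suc n)" by (simp add: c_def v_def)
      then show ?thesis
        using ik True v[of i] unfolding eq sum_jac_row[OF ik(1)]
        by (auto simp: add_eq_0_iff not_less less_Suc_eq simp del: sum.op_ivl_Suc)
    next
      case False
      then show ?thesis using ik unfolding eq
        by (simp add: if_distrib[of "\<lambda>y. _ * y"] cong: if_cong del: sum.op_ivl_Suc)
    qed
  qed auto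
  then have "det ?B = det ?R"
    using det_mult[of ?B "Suc n" ?U] U by simp
  also have "\<dots> = (\<Sum>i<Suc n. ?R $$ (i, 0) * cofactor ?R i 0)"
    by (rule laplace_expansion_column) auto
  also have "\<dots> = c * cofactor ?R n 0"
    by (simp add: lessThan_Suc)
  also have "cofactor ?R n 0 = (-1) ^ n * det (mat_delete ?R n 0)"
    by (simp add: cofactor_def)
  \<comment> \<open>Deleting the last row and the first column moves the superdiagonal ones onto the
    diagonal.\<close>
  also have "det (mat_delete ?R n 0) = prod_list (diag_mat (mat_delete ?R n 0))"
    by (rule det_lower_triangular[where n = n]) (auto simp: mat_delete_def jac_def)
  also have "\<dots> = 1"
    by (auto simp: prod_list_diag_prod mat_delete_def jac_def intro!: prod.neutral)
  finally show ?thesis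
    by (cases "even n") (simp_all add: c_def)
qed


text \<open>The adjugate of the truncation of \<open>x + T\<close> to size \<open>n + 1\<close>, up to the signs \<open>(-1)\<^sup>k\<^sup>+\<^sup>j\<close>.\<close>

definition green :: "(nat \<Rightarrow> 'a :: comm_ring_1) \<Rightarrow> (nat \<Rightarrow> 'a) \<Rightarrow> nat \<Rightarrow> 'a \<Rightarrow> nat \<Rightarrow> nat \<Rightarrow> 'a" where
  "green s t n x k j =
     (if k \<le> j then opoly s t 0 k x * opoly s t (Suc j) (n - j) x
      else opoly s t 0 j x * opoly s t (Suc k) (n - k) x * (\<Prod>l\<in>{j..<k}. t l))"

text \<open>A discrete Green's function: up to signs and products of \<open>t\<close>, column
  \<open>j\<close> follows the solution \<open>p\<close> from the top end down to row
  \<open>j\<close>, and the solution \<open>q\<close> from the bottom end below it. Rows other than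
  \<open>j\<close> vanish by the two recurrences; row \<open>j\<close> yields the Wronskian of
  \<open>p\<close> and \<open>q\<close>.\<close>

lemma jac_green:
  assumes i: "i \<le> n" and j: "j \<le> n"
  shows "(\<Sum>k = 0..<Suc n. jac s t x i k * ((-1) ^ (k + j) * green s t n x k j)) =
    (if i = j then opoly s t 0 (Suc n) x else 0)"
proof -
  define p where "p k = opoly s t 0 k x" for k
  \<comment> \<open>The value 0 at \<open>Suc n\<close> is the boundary condition at the bottom end;
    with it the last row needs no separate recurrence.\<close>
  define q where "q k = (if k \<le> n then opoly s t (Suc k) (n - k) x else 0)" for k
  define g where "g k = (if k \<le> j then p k * q j else p j * q k * (\<Prod>l\<in>{j..<k}. t l))" for k
  have g: "green s t n x k j = g k" if "k \<le> n" for k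
    using that j by (simp add: green_def g_def p_def q_def)
  have g_end: "g (Suc n) = 0"
    using j by (simp add: g_def q_def)
  have p_rec: "p (Suc k) = (x + s k) * p k - (if k = 0 then 0 else t (k - 1) * p (k - 1))" for k
    by (cases k) (simp_all add: p_def)
  \<comment> \<open>This recurrence runs in the offset: the first row is split off instead of the
    last one.\<close>
  have q_rec: "q k = (x + s (Suc k)) * q (Suc k) - t (Suc k) * q (Suc (Suc k))"
    if k: "k < n" for k
  proof (cases "Suc k = n")
    case True
    then show ?thesis by (auto simp: q_def)
  next
    case False
    define m where "m = n - Suc (Suc k)"
    have "n - k = Suc 0 + Suc m" "n - Suc k = Suc m" using k False by (auto simp: m_def)
    then show ?thesis using k False opoly_split[of s t "Suc k" 0 m x]
      by (simp add: q_def m_def)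
  qed
  \<comment> \<open>This is the splitting at the cut after row \<open>k\<close>, whose left-hand
    side does not depend on \<open>k\<close>.\<close>
  have wronskian: "p (Suc k) * q k - t k * p k * q (Suc k) = p (Suc n)" if k: "k \<le> n" for k
  proof (cases "k = n")
    case True
    then show ?thesis by (simp add: q_def)
  next
    case False
    define m where "m = n - Suc k"
    have "Suc n = Suc k + Suc m" "n - k = Suc m" using k False by (auto simp: m_def)
    then show ?thesis using k False opoly_split[of s t 0 k m x]
      by (simp add: q_def p_def m_def)
  qed
  have "(\<Sum>k = 0..<Suc n. jac s t x i k * ((-1) ^ (k + j) * green s t n x k j)) =
      (\<Sum>k = 0..<Suc n. jac s t x i k * ((-1) ^ (k + j) * g k))"
    by (intro sum.cong refl) (simp add: g)
  also have "\<dots> = (if i = 0 then 0 else t (i - 1) * ((-1) ^ (i - 1 + j) * g (i - 1)))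
      + (x + s i) * ((-1) ^ (i + j) * g i)
      + (if Suc i < Suc n then (-1) ^ (Suc i + j) * g (Suc i) else 0)"
    by (rule sum_jac_row) (use i in simp)
  also have "(if Suc i < Suc n then (-1) ^ (Suc i + j) * g (Suc i) else 0) =
      (-1) ^ (Suc i + j) * g (Suc i)"
    using i g_end by (cases "i = n") auto
  also have "(if i = 0 then 0 else t (i - 1) * ((-1) ^ (i - 1 + j) * g (i - 1)))
      + (x + s i) * ((-1) ^ (i + j) * g i) + (-1) ^ (Suc i + j) * g (Suc i) =
      (-1) ^ (i + j) *
        ((x + s i) * g i - (if i = 0 then 0 else t (i - 1) * g (i - 1)) - g (Suc i))"
    by (cases i) (simp_all add: algebra_simps)
  also have "\<dots> = (if i = j then p (Suc n) else 0)"
  proof (cases i j rule: linorder_cases)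
    case less
    then have "(x + s i) * g i - (if i = 0 then 0 else t (i - 1) * g (i - 1)) - g (Suc i) =
        q j * ((x + s i) * p i - (if i = 0 then 0 else t (i - 1) * p (i - 1)) - p (Suc i))"
      by (cases i) (simp_all add: g_def algebra_simps)
    also have "\<dots> = 0"
      using p_rec[of i] by simp
    finally have "(x + s i) * g i - (if i = 0 then 0 else t (i - 1) * g (i - 1)) - g (Suc i) = 0" .
    then show ?thesis using less by simp
  next
    case equal
    have "(x + s i) * g i - (if i = 0 then 0 else t (i - 1) * g (i - 1)) - g (Suc i) =
        ((x + s i) * p i - (if i = 0 then 0 else t (i - 1) * p (i - 1))) * q i
        - t i * p i * q (Suc i)"
      using equal by (cases i) (simp_all add: g_def algebra_simps)
    also have "\<dots> = p (Suc i) * q i - t i * p i * q (Suc i)"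
      by (simp only: p_rec[of i])
    finally have "(x + s i) * g i - (if i = 0 then 0 else t (i - 1) * g (i - 1)) - g (Suc i) =
        p (Suc i) * q i - t i * p i * q (Suc i)" .
    then show ?thesis using equal wronskian[OF i] by (simp flip: power_mult_distrib mult_2)
  next
    case greater
    then obtain i' where i': "i = Suc i'" "j \<le> i'" "i' < n"
      using i by (cases i) auto
    \<comment> \<open>The case \<open>i' = j\<close> is included: there the product is empty and
      both branches of \<open>g\<close> agree.\<close>
    have gi': "g i' = p j * q i' * (\<Prod>l\<in>{j..<i'}. t l)"
      using i' by (auto simp: g_def)
    have gi: "g i = p j * q i * (\<Prod>l\<in>{j..<i'}. t l) * t i'"
      "g (Suc i) = p j * q (Suc i) * (\<Prod>l\<in>{j..<i'}. t l) * t i' * t i"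
      using i' by (simp_all add: g_def)
    have "(x + s i) * g i - (if i = 0 then 0 else t (i - 1) * g (i - 1)) - g (Suc i) =
        p j * (\<Prod>l\<in>{j..<i'}. t l) * t i' * ((x + s i) * q i - t i * q (Suc i) - q i')"
      unfolding gi using i'(1) gi' by (simp add: algebra_simps)
    also have "\<dots> = 0"
      using q_rec[OF i'(3)] i'(1) by simp
    finally have "(x + s i) * g i - (if i = 0 then 0 else t (i - 1) * g (i - 1)) - g (Suc i) = 0" .
    then show ?thesis using greater by simp
  qed
  finally show ?thesis by (simp add: p_def)
qed

section \<open>Determinant of the triple product via kernel vectors\<close>

text \<open>The row vector \<open>z\<close> annihilates all columns but the first, so a row
  operation with first row \<open>z\<close> leaves only the sum of \<open>z k * v k\<close> in the
  top row. The remaining block is triangular with diagonal \<open>t 0, ..., t (n - 1)\<close>; its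
  determinant and that of the row operation are both \<open>z 0\<close>, which cancels as
  \<open>t\<close> does not vanish.\<close>

lemma det_jac_border:
  assumes t: "\<And>l. l < n \<Longrightarrow> t l \<noteq> (0 :: 'a :: idom)"
  shows "det (mat (Suc n) (Suc n) (\<lambda>(k, j). if j = 0 then v k else jac s t x k (j - 1))) =
    (\<Sum>k = 0..<Suc n. (-1) ^ k * opoly s t 0 k x * (\<Prod>l\<in>{k..<n}. t l) * v k)"
proof -
  \<comment> \<open>Tail products of \<open>t\<close>, instead of inverses of initial products, keep
    \<open>z\<close> inside the ring.\<close>
  define z where "z k = (-1) ^ k * opoly s t 0 k x * (\<Prod>l\<in>{k..<n}. t l)" for k
  let ?Z = "mat (Suc n) (Suc n) (\<lambda>(k, j). if j = 0 then v k else jac s t x k (j - 1))"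
  let ?U = "mat (Suc n) (Suc n) (\<lambda>(i, k). if i = 0 then z k else if i = k then 1 else 0)"
  let ?S = "mat n n (\<lambda>(i, j). jac s t x (Suc i) j)"
  let ?R = "four_block_mat (mat 1 1 (\<lambda>_. \<Sum>k = 0..<Suc n. z k * v k)) (0\<^sub>m 1 n)
    (mat n 1 (\<lambda>(i, j). v (Suc i))) ?S"
  have prod_t: "(\<Prod>l\<in>{k..<n}. t l) = t k * (\<Prod>l\<in>{Suc k..<n}. t l)" if "k < n" for k
    using that by (rule prod.atLeast_Suc_lessThan)
  have z: "(if j = 0 then 0 else z (j - 1)) + z j * (x + s j) + z (Suc j) * t j = 0"
    if "j < n" for j
    using that prod_t[of j] prod_t[of "j - 1"]
    by (cases j) (simp_all add: z_def algebra_simps)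
  have "det ?U = prod_list (diag_mat ?U)"
    by (rule det_upper_triangular[where n = "Suc n"]) auto
  also have "\<dots> = z 0"
    by (simp add: prod_list_diag_prod prod.atLeast0_lessThan_Suc_shift del: prod.op_ivl_Suc)
  finally have U: "det ?U = z 0" .
  have "?U * ?Z = ?R"
  proof (rule eq_matI)
    fix i j assume "i < dim_row ?R" "j < dim_col ?R"
    then have ij: "i < Suc n" "j < Suc n" by auto
    have eq: "(?U * ?Z) $$ (i, j) = (\<Sum>k = 0..<Suc n. (if i = 0 then z k else if i = k then 1 else 0)
        * (if j = 0 then v k else jac s t x k (j - 1)))"
      using ij by (simp add: scalar_prod_def)
    show "(?U * ?Z) $$ (i, j) = ?R $$ (i, j)"
    proof (cases i)
      case 0
      show ?thesis
      proof (cases j)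
        case (Suc j')
        have "(\<Sum>k = 0..<Suc n. z k * jac s t x k j') = 0"
          using z[of j'] ij Suc by (subst sum_jac_col) auto
        then show ?thesis unfolding eq using ij 0 Suc by (simp del: sum.op_ivl_Suc)
      qed (use ij 0 eq in \<open>simp del: sum.op_ivl_Suc\<close>)
    next
      case (Suc i')
      then show ?thesis unfolding eq using ij
        by (simp add: if_distrib[of "\<lambda>y. y * _"] cong: if_cong del: sum.op_ivl_Suc)
    qed
  qed auto
  then have "z 0 * det ?Z = det ?R"
    using det_mult[of ?U "Suc n" ?Z] U by simp
  also have "\<dots> = det (mat 1 1 (\<lambda>_. \<Sum>k = 0..<Suc n. z k * v k)) * det ?S"
    by (rule det_four_block_mat_upper_right_zero) auto
  also have "det ?S = prod_list (diag_mat ?S)"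
    by (rule det_upper_triangular[where n = n]) (auto simp: jac_def)
  also have "\<dots> = z 0"
    by (simp add: prod_list_diag_prod z_def jac_def)
  finally have "z 0 * det ?Z = z 0 * (\<Sum>k = 0..<Suc n. z k * v k)"
    by (simp add: det_single mult.commute)
  moreover have "z 0 \<noteq> 0"
    using t by (simp add: z_def)
  ultimately show ?thesis
    by (simp add: z_def mult.assoc)
qed


text \<open>\<open>B\<close> maps \<open>v\<close> to \<open>d * x\<close>, where
  \<open>d = det B\<close>, and \<open>A\<close> annihilates \<open>x\<close>. So
  \<open>?X * (B * ?Z)\<close> is block triangular with diagonal blocks \<open>d\<close> and
  \<open>A * (B * C)\<close>. Comparing determinants and cancelling \<open>d\<close> leaves
  \<open>det ?Z\<close>.\<close>

lemma det_jac_product: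
  fixes s t :: "nat \<Rightarrow> 'a :: idom" and a b c :: 'a
  assumes t: "\<And>l. l < n \<Longrightarrow> t l \<noteq> 0" and nonzero: "opoly s t 0 (Suc n) b \<noteq> 0"
  defines "A \<equiv> mat n (Suc n) (\<lambda>(i, k). jac s t a i k)"
    and "B \<equiv> mat (Suc n) (Suc n) (\<lambda>(i, k). jac s t b i k)"
    and "C \<equiv> mat (Suc n) n (\<lambda>(i, k). jac s t c i k)"
  shows "det (A * B * C) =
    (\<Sum>k = 0..<Suc n. \<Sum>j = 0..<Suc n. opoly s t 0 j a * opoly s t 0 k c
       * green s t n b k j * (\<Prod>l\<in>{k..<n}. t l))"
proof -
  define d where "d = opoly s t 0 (Suc n) b"
  define x where "x j = (-1) ^ j * opoly s t 0 j a" for j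
  define v where "v k = (\<Sum>j = 0..<Suc n. (-1) ^ (k + j) * green s t n b k j * x j)" for k
  \<comment> \<open>The extra top row shifts the superdiagonal ones of \<open>A\<close> onto the
    diagonal, so \<open>?X\<close> is unitriangular.\<close>
  let ?X = "mat (Suc n) (Suc n) (\<lambda>(i, k).
    if i = 0 then if k = 0 then 1 else 0 else jac s t a (i - 1) k)"
  let ?Z = "mat (Suc n) (Suc n) (\<lambda>(k, j). if j = 0 then v k else jac s t c k (j - 1))"
  let ?Y = "mat (Suc n) (Suc n) (\<lambda>(k, j). if j = 0 then d * x k else (B * C) $$ (k, j - 1))"
  let ?R = "four_block_mat (mat 1 1 (\<lambda>_. d)) (mat 1 n (\<lambda>(i, j). (B * C) $$ (0, j)))
    (0\<^sub>m n 1) (A * (B * C))"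
  have carrier: "A \<in> carrier_mat n (Suc n)" "B \<in> carrier_mat (Suc n) (Suc n)"
    "C \<in> carrier_mat (Suc n) n"
    by (auto simp: A_def B_def C_def)
  have dims: "dim_row A = n" "dim_col A = Suc n" "dim_row B = Suc n" "dim_col B = Suc n"
    "dim_row C = Suc n" "dim_col C = n"
    using carrier by auto
  have Ax: "(\<Sum>k = 0..<Suc n. jac s t a i k * x k) = 0" if "i < n" for i
  proof -
    have "(if i = 0 then 0 else t (i - 1) * x (i - 1)) + (a + s i) * x i + x (Suc i) = 0"
      by (cases i) (simp_all add: x_def algebra_simps)
    then show ?thesis using that by (subst sum_jac_row) auto
  qed
  have Bv: "(\<Sum>k = 0..<Suc n. jac s t b i k * v k) = d * x i" if "i \<le> n" for i
  proof -
    have "(\<Sum>k = 0..<Suc n. jac s t b i k * v k) =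
        (\<Sum>k = 0..<Suc n. \<Sum>j = 0..<Suc n.
          jac s t b i k * ((-1) ^ (k + j) * green s t n b k j) * x j)"
      unfolding v_def sum_distrib_left by (simp only: mult.assoc)
    also have "\<dots> = (\<Sum>j = 0..<Suc n. (\<Sum>k = 0..<Suc n.
          jac s t b i k * ((-1) ^ (k + j) * green s t n b k j)) * x j)"
      unfolding sum_distrib_right by (rule sum.swap)
    also have "\<dots> = (\<Sum>j = 0..<Suc n. (if i = j then d else 0) * x j)"
      by (intro sum.cong refl arg_cong2[of _ _ _ _ "(*)"], subst jac_green)
        (use that in \<open>auto simp: d_def\<close>)
    also have "\<dots> = d * x i"
      using that by (simp add: if_distrib[of "\<lambda>y. y * _"] cong: if_cong del: sum.op_ivl_Suc)
    finally show ?thesis .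
  qed
  have X: "det ?X = 1"
  proof -
    have "det ?X = prod_list (diag_mat ?X)"
      by (rule det_lower_triangular[where n = "Suc n"]) (auto simp: jac_def)
    also have "\<dots> = 1"
      by (auto simp: prod_list_diag_prod jac_def intro!: prod.neutral)
    finally show ?thesis .
  qed
  have BZ: "B * ?Z = ?Y"
  proof (rule eq_matI)
    fix k j assume "k < dim_row ?Y" "j < dim_col ?Y"
    then show "(B * ?Z) $$ (k, j) = ?Y $$ (k, j)"
      using Bv[of k] by (cases j) (auto simp: B_def C_def scalar_prod_def simp del: sum.op_ivl_Suc)
  qed (auto simp: B_def)
  have "?X * ?Y = ?R"
  proof (rule eq_matI)
    fix i j assume "i < dim_row ?R" "j < dim_col ?R"
    then have ij: "i < Suc n" "j < Suc n" using dims by auto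
    have eq: "(?X * ?Y) $$ (i, j) = (\<Sum>k = 0..<Suc n.
        (if i = 0 then if 0 = k then 1 else 0 else jac s t a (i - 1) k)
        * (if j = 0 then d * x k else (B * C) $$ (k, j - 1)))"
      using ij by (auto simp: scalar_prod_def intro!: sum.cong)
    show "(?X * ?Y) $$ (i, j) = ?R $$ (i, j)"
    proof (cases i)
      case 0
      then show ?thesis unfolding eq using ij dims
        by (auto simp: if_distrib[of "\<lambda>y. y * _"] x_def cong: if_cong
            simp del: sum.op_ivl_Suc index_mult_mat(1))
    next
      case (Suc i')
      show ?thesis
      proof (cases j)
        case 0
        have "(\<Sum>k = 0..<Suc n. jac s t a i' k * (d * x k)) =
            d * (\<Sum>k = 0..<Suc n. jac s t a i' k * x k)"
          by (simp only: sum_distrib_left mult.left_commute)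
        then show ?thesis unfolding eq using ij dims Suc 0 Ax[of i']
          by (simp del: sum.op_ivl_Suc)
      next
        case j: (Suc j')
        have "(A * (B * C)) $$ (i', j') =
            (\<Sum>k = 0..<Suc n. jac s t a i' k * (B * C) $$ (k, j'))"
          using ij Suc j dims
          by (subst index_mult_mat)
            (auto simp: scalar_prod_def A_def simp del: sum.op_ivl_Suc intro!: sum.cong)
        then show ?thesis unfolding eq using ij dims Suc j
          by (simp del: sum.op_ivl_Suc index_mult_mat(1))
      qed
    qed
  qed (use dims in auto)
  then have "det (?X * ?Y) = d * det (A * (B * C))"
    using carrier by (simp add: det_single det_four_block_mat_lower_left_zero[where n = 1 and m = n])
  then have "d * det (A * (B * C)) = det ?X * (det B * det ?Z)"
    using carrier by (simp add: det_mult[of _ "Suc n"] flip: BZ)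
  also have "det B = d"
    unfolding B_def d_def by (rule det_tridiagonal)
  finally have "det (A * (B * C)) = det ?Z"
    using nonzero X by (simp add: d_def)
  also have "\<dots> = (\<Sum>k = 0..<Suc n. (-1) ^ k * opoly s t 0 k c * (\<Prod>l\<in>{k..<n}. t l) * v k)"
    by (rule det_jac_border) (use t in auto)
  also have "\<dots> = (\<Sum>k = 0..<Suc n. \<Sum>j = 0..<Suc n. opoly s t 0 j a * opoly s t 0 k c
       * green s t n b k j * (\<Prod>l\<in>{k..<n}. t l))"
    unfolding v_def sum_distrib_left
  proof (intro sum.cong refl)
    fix k j
    \<comment> \<open>The signs of the left kernel vector, of the adjugate and of \<open>x\<close>
      cancel.\<close>
    have "(-1) ^ k * (-1) ^ (k + j) * (-1 :: 'a) ^ j = 1"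
      by (simp add: power_add flip: power_mult_distrib)
    moreover have "(-1) ^ k * opoly s t 0 k c * (\<Prod>l\<in>{k..<n}. t l)
        * ((-1) ^ (k + j) * green s t n b k j * x j) =
        ((-1) ^ k * (-1) ^ (k + j) * (-1) ^ j) *
        (opoly s t 0 j a * opoly s t 0 k c * green s t n b k j * (\<Prod>l\<in>{k..<n}. t l))"
      unfolding x_def by (simp only: mult_ac)
    ultimately show "(-1) ^ k * opoly s t 0 k c * (\<Prod>l\<in>{k..<n}. t l)
        * ((-1) ^ (k + j) * green s t n b k j * x j) =
        opoly s t 0 j a * opoly s t 0 k c * green s t n b k j * (\<Prod>l\<in>{k..<n}. t l)"
      by simp
  qed
  finally show ?thesis
    using carrier by (simp add: assoc_mult_mat[of _ n "Suc n" _ "Suc n" _ n])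
qed


section \<open>Moments and the factorization of the Hankel matrix\<close>

text \<open>The ring-generic form of \<open>moment2\<close>: entry \<open>(0, k)\<close> of the
  \<open>n\<close>-th power of \<open>T\<close>, that is, the total weight of Motzkin paths from
  height 0 to height \<open>k\<close>.\<close>

fun walk :: "(nat \<Rightarrow> 'a :: comm_ring_1) \<Rightarrow> (nat \<Rightarrow> 'a) \<Rightarrow> nat \<Rightarrow> nat \<Rightarrow> 'a" where
  "walk s t 0 k = of_bool (k = 0)"
| "walk s t (Suc n) k =
     (if k = 0 then 0 else walk s t n (k - 1)) + s k * walk s t n k + t k * walk s t n (Suc k)"

lemma walk_eq_0: "n < k \<Longrightarrow> walk s t n k = 0"
  by (induction n arbitrary: k) auto

lemma walk_diag: "walk s t n n = 1"
  by (induction n) (auto simp: walk_eq_0)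

text \<open>\<open>T\<close> is self-adjoint for the weights \<open>\<Prod>r<l. t r\<close>, because
  passing from \<open>l\<close> to \<open>Suc l\<close> multiplies the weight by \<open>t l\<close>.
  Hence steps can be moved from the second walk to the first until the second is empty.\<close>

lemma sum_walk_mult:
  assumes "j < N"
  shows "(\<Sum>l = 0..<N. walk s t i l * (\<Prod>r<l. t r) * walk s t j l) = walk s t (i + j) 0"
  using assms
proof (induction j arbitrary: i)
  case 0
  have "(\<Sum>l = 0..<N. walk s t i l * (\<Prod>r<l. t r) * walk s t 0 l) =
      (\<Sum>l = 0..<N. if 0 = l then walk s t i l * (\<Prod>r<l. t r) else 0)"
    by (intro sum.cong) auto
  then show ?case using 0 by simp
next
  case (Suc j)
  let ?d = "\<lambda>l. \<Prod>r<l. t r"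
  let ?w = "walk s t"
  \<comment> \<open>Since \<open>j < M\<close>, the walk of length \<open>j\<close> vanishes at
    \<open>M\<close> and \<open>Suc M\<close>, so the index shifts below lose only zero
    terms.\<close>
  obtain M where M: "N = Suc M" "j < M"
    using Suc.prems by (cases N) auto
  have shift: "(\<Sum>l = 0..<N. if l = 0 then 0 else f (l - 1)) = (\<Sum>l = 0..<M. f l)"
    for f :: "nat \<Rightarrow> 'a"
    unfolding M(1) by (subst sum.atLeast0_lessThan_Suc_shift) simp
  have last: "(\<Sum>l = 0..<M. f l) = (\<Sum>l = 0..<N. f l)" if "f M = 0" for f :: "nat \<Rightarrow> 'a"
    using that by (simp add: M(1))
  have up: "(\<Sum>l = 0..<N. ?w i l * ?d l * (if l = 0 then 0 else ?w j (l - 1))) =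
      (\<Sum>l = 0..<N. t l * ?w i (Suc l) * ?d l * ?w j l)"
  proof -
    have "(\<Sum>l = 0..<N. ?w i l * ?d l * (if l = 0 then 0 else ?w j (l - 1))) =
        (\<Sum>l = 0..<N. if l = 0 then 0 else t (l - 1) * ?w i (Suc (l - 1)) * ?d (l - 1) * ?w j (l - 1))"
    proof (intro sum.cong refl)
      fix l
      show "?w i l * ?d l * (if l = 0 then 0 else ?w j (l - 1)) =
        (if l = 0 then 0 else t (l - 1) * ?w i (Suc (l - 1)) * ?d (l - 1) * ?w j (l - 1))"
        by (cases l) (simp_all add: mult_ac)
    qed
    also have "\<dots> = (\<Sum>l = 0..<M. t l * ?w i (Suc l) * ?d l * ?w j l)"
      by (rule shift)
    also have "\<dots> = (\<Sum>l = 0..<N. t l * ?w i (Suc l) * ?d l * ?w j l)"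
      by (rule last) (use M in \<open>simp add: walk_eq_0\<close>)
    finally show ?thesis .
  qed
  have down: "(\<Sum>l = 0..<N. ?w i l * ?d l * (t l * ?w j (Suc l))) =
      (\<Sum>l = 0..<N. (if l = 0 then 0 else ?w i (l - 1)) * ?d l * ?w j l)"
  proof -
    have "(\<Sum>l = 0..<N. ?w i l * ?d l * (t l * ?w j (Suc l))) =
        (\<Sum>l = 0..<M. ?w i l * ?d l * (t l * ?w j (Suc l)))"
      by (rule last[symmetric]) (use M in \<open>simp add: walk_eq_0\<close>)
    also have "\<dots> = (\<Sum>l = 0..<N. if l = 0 then 0 else
        ?w i (l - 1) * ?d (l - 1) * (t (l - 1) * ?w j (Suc (l - 1))))"
      by (rule shift[symmetric])
    also have "\<dots> = (\<Sum>l = 0..<N. (if l = 0 then 0 else ?w i (l - 1)) * ?d l * ?w j l)"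
    proof (intro sum.cong refl)
      fix l
      show "(if l = 0 then 0 else ?w i (l - 1) * ?d (l - 1) * (t (l - 1) * ?w j (Suc (l - 1)))) =
        (if l = 0 then 0 else ?w i (l - 1)) * ?d l * ?w j l"
        by (cases l) (simp_all add: mult_ac)
    qed
    finally show ?thesis .
  qed
  have "(\<Sum>l = 0..<N. ?w i l * ?d l * ?w (Suc j) l) =
      (\<Sum>l = 0..<N. ?w i l * ?d l * (if l = 0 then 0 else ?w j (l - 1)))
      + (\<Sum>l = 0..<N. ?w i l * ?d l * (s l * ?w j l))
      + (\<Sum>l = 0..<N. ?w i l * ?d l * (t l * ?w j (Suc l)))"
    unfolding sum.distrib[symmetric]
    by (intro sum.cong refl) (simp only: walk.simps distrib_left mult.assoc)
  also have "\<dots> = (\<Sum>l = 0..<N. ?w (Suc i) l * ?d l * ?w j l)"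
    unfolding up down sum.distrib[symmetric]
    by (intro sum.cong refl) (simp only: walk.simps algebra_simps)
  also have "\<dots> = ?w (Suc i + j) 0"
    using Suc.prems by (intro Suc.IH) auto
  finally show ?case by simp
qed


text \<open>With \<open>E\<close> the shift of the row index, the coefficients are those of
  \<open>(a + E)(b + E)(c + E)\<close>, and multiplying \<open>M\<close> by \<open>x + T\<close>
  from the right acts as \<open>x + E\<close>. So the numerator matrix is
  \<open>M * (A * B * C) * K\<close> and the denominator matrix is \<open>M * K\<close>, where
  \<open>det M = 1\<close> and \<open>det K\<close> is nonzero.\<close>

lemma det_walk_product:
  fixes s t :: "nat \<Rightarrow> 'a :: field" and a b c :: 'a
  assumes t: "\<And>l. l < n \<Longrightarrow> t l \<noteq> 0" and nonzero: "opoly s t 0 (Suc n) b \<noteq> 0"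
  defines "w \<equiv> \<lambda>i. walk s t i 0"
  shows "det (mat n n (\<lambda>(i, j). a * b * c * w (i + j) + (a * b + b * c + c * a) * w (i + j + 1)
          + (a + b + c) * w (i + j + 2) + w (i + j + 3)))
      / det (mat n n (\<lambda>(i, j). w (i + j))) =
    (\<Sum>k = 0..<Suc n. \<Sum>j = 0..<Suc n. opoly s t 0 j a * opoly s t 0 k c
       * green s t n b k j * (\<Prod>l\<in>{k..<n}. t l))"
proof -
  define M where "M = mat n n (\<lambda>(i, k). walk s t i k)"
  define K where "K = mat n n (\<lambda>(k, j). (\<Prod>r<k. t r) * walk s t j k)"
  define A where "A = mat n (Suc n) (\<lambda>(i, k). jac s t a i k)"
  define B where "B = mat (Suc n) (Suc n) (\<lambda>(i, k). jac s t b i k)"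
  define C where "C = mat (Suc n) n (\<lambda>(i, k). jac s t c i k)"
  define u where "u i k = a * walk s t i k + walk s t (Suc i) k" for i k
  define v where "v i k = b * u i k + u (Suc i) k" for i k
  define y where "y i k = c * v i k + v (Suc i) k" for i k
  have carrier: "M \<in> carrier_mat n n" "K \<in> carrier_mat n n" "A \<in> carrier_mat n (Suc n)"
    "B \<in> carrier_mat (Suc n) (Suc n)" "C \<in> carrier_mat (Suc n) n"
    by (auto simp: M_def K_def A_def B_def C_def)
  \<comment> \<open>The last premise ensures that truncating \<open>x + T\<close> to
    \<open>N\<close> rows loses nothing in column \<open>k\<close>.\<close>
  have step: "(\<Sum>l = 0..<N. f i l * jac s t x l k) = x * f i k + f (Suc i) k"
    if "\<And>i k. f (Suc i) k = (if k = 0 then 0 else f i (k - 1)) + s k * f i k + t k * f i (Suc k)"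
      "k < N" "Suc k < N \<or> f i (Suc k) = 0" for f :: "nat \<Rightarrow> nat \<Rightarrow> 'a" and x i k N
    using that(2,3) by (subst sum_jac_col, simp, subst that(1)) (auto simp: algebra_simps)
  have u_rec: "u (Suc i) k = (if k = 0 then 0 else u i (k - 1)) + s k * u i k + t k * u i (Suc k)"
    for i k by (simp add: u_def algebra_simps)
  have v_rec: "v (Suc i) k = (if k = 0 then 0 else v i (k - 1)) + s k * v i k + t k * v i (Suc k)"
    for i k unfolding v_def u_rec[of "Suc i"] u_rec[of i] by (simp add: algebra_simps)
  have MA: "M * A = mat n (Suc n) (\<lambda>(i, k). u i k)"
  proof (rule eq_matI)
    fix i k assume "i < dim_row (mat n (Suc n) (\<lambda>(i, k). u i k))"
      "k < dim_col (mat n (Suc n) (\<lambda>(i, k). u i k))"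
    then have ik: "i < n" "k < Suc n" by auto
    then have "(M * A) $$ (i, k) = (\<Sum>l = 0..<n. walk s t i l * jac s t a l k)"
      by (simp add: M_def A_def scalar_prod_def)
    also have "\<dots> = (\<Sum>l = 0..<Suc n. walk s t i l * jac s t a l k)"
      using ik by (simp add: walk_eq_0)
    also have "\<dots> = u i k"
    proof -
      have "Suc k < Suc n \<or> walk s t i (Suc k) = 0"
        using ik by (cases "k < n") (simp_all add: walk_eq_0)
      then show ?thesis
        unfolding u_def using ik by (intro step) simp_all
    qed
    finally show "(M * A) $$ (i, k) = mat n (Suc n) (\<lambda>(i, k). u i k) $$ (i, k)"
      using ik by simp
  qed (auto simp: M_def A_def)
  have MAB: "M * A * B = mat n (Suc n) (\<lambda>(i, k). v i k)"
  proof (rule eq_matI)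
    fix i k assume "i < dim_row (mat n (Suc n) (\<lambda>(i, k). v i k))"
      "k < dim_col (mat n (Suc n) (\<lambda>(i, k). v i k))"
    then have ik: "i < n" "k < Suc n" by auto
    then have "(M * A * B) $$ (i, k) = (\<Sum>l = 0..<Suc n. u i l * jac s t b l k)"
      unfolding MA by (simp add: B_def scalar_prod_def del: sum.op_ivl_Suc)
    also have "\<dots> = v i k"
    proof -
      have "Suc k < Suc n \<or> u i (Suc k) = 0"
        using ik by (cases "k < n") (simp_all add: u_def walk_eq_0 del: walk.simps)
      then show ?thesis
        unfolding v_def using ik by (intro step u_rec) simp_all
    qed
    finally show "(M * A * B) $$ (i, k) = mat n (Suc n) (\<lambda>(i, k). v i k) $$ (i, k)"
      using ik by simp
  qed (auto simp: M_def B_def)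
  \<comment> \<open>\<open>v i (Suc n)\<close> may be nonzero, but the columns of \<open>C\<close>
    have index below \<open>n\<close> and reach only row \<open>n\<close>; hence
    \<open>n + 1\<close> middle indices suffice.\<close>
  have MABC: "M * A * B * C = mat n n (\<lambda>(i, k). y i k)"
  proof (rule eq_matI)
    fix i k assume "i < dim_row (mat n n (\<lambda>(i, k). y i k))"
      "k < dim_col (mat n n (\<lambda>(i, k). y i k))"
    then have ik: "i < n" "k < n" by auto
    then have "(M * A * B * C) $$ (i, k) = (\<Sum>l = 0..<Suc n. v i l * jac s t c l k)"
      unfolding MAB by (simp add: C_def scalar_prod_def del: sum.op_ivl_Suc)
    also have "\<dots> = y i k"
      unfolding y_def using ik by (intro step v_rec) auto
    finally show "(M * A * B * C) $$ (i, k) = mat n n (\<lambda>(i, k). y i k) $$ (i, k)"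
      using ik by simp
  qed (auto simp: M_def C_def)
  \<comment> \<open>Only \<open>j\<close> is bounded by \<open>n\<close>; \<open>i\<close> is free,
    so the rows shifted by up to 3 still produce moments.\<close>
  have w: "(\<Sum>k = 0..<n. walk s t i k * ((\<Prod>r<k. t r) * walk s t j k)) = w (i + j)"
    if "j < n" for i j
    using sum_walk_mult[OF that, of s t i] by (simp add: w_def mult.assoc)
  have H: "mat n n (\<lambda>(i, j). w (i + j)) = M * K"
    by (rule eq_matI) (auto simp: M_def K_def scalar_prod_def w)
  have "mat n n (\<lambda>(i, j). a * b * c * w (i + j) + (a * b + b * c + c * a) * w (i + j + 1)
          + (a + b + c) * w (i + j + 2) + w (i + j + 3)) = M * A * B * C * K" (is "?L = _")
  proof (rule eq_matI)
    fix i j assume "i < dim_row (M * A * B * C * K)" "j < dim_col (M * A * B * C * K)"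
    then have ij: "i < n" "j < n" by (auto simp: M_def K_def)
    let ?e = "\<lambda>k. (\<Prod>r<k. t r) * walk s t j k"
    have "(M * A * B * C * K) $$ (i, j) = (\<Sum>k = 0..<n. y i k * ?e k)"
      unfolding MABC using ij by (simp add: K_def scalar_prod_def)
    also have "\<dots> = (\<Sum>k = 0..<n. a * b * c * (walk s t i k * ?e k)
        + (a * b + b * c + c * a) * (walk s t (Suc i) k * ?e k)
        + (a + b + c) * (walk s t (Suc (Suc i)) k * ?e k)
        + walk s t (Suc (Suc (Suc i))) k * ?e k)"
      by (intro sum.cong refl) (simp add: y_def v_def u_def algebra_simps del: walk.simps)
    also have "\<dots> = ?L $$ (i, j)"
      using ij by (simp add: sum.distrib w flip: sum_distrib_left del: walk.simps)
        (simp add: numeral_eq_Suc)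
    finally show "?L $$ (i, j) = (M * A * B * C * K) $$ (i, j)" by simp
  qed (auto simp: M_def K_def)
  also have "\<dots> = M * (A * B * C) * K"
    using carrier
    by (simp add: assoc_mult_mat[of M n n A "Suc n" B "Suc n"]
        assoc_mult_mat[of M n n "A * B" "Suc n" C n])
  finally have L: "?L = M * (A * B * C) * K" .
  have M: "det M = 1"
  proof -
    have "det M = prod_list (diag_mat M)"
      by (rule det_lower_triangular[where n = n]) (auto simp: M_def walk_eq_0)
    also have "\<dots> = 1"
      by (auto simp: prod_list_diag_prod M_def walk_diag intro!: prod.neutral)
    finally show ?thesis .
  qed
  have K: "det K \<noteq> 0"
  proof -
    have "det K = prod_list (diag_mat K)"
      by (rule det_upper_triangular[where n = n]) (auto simp: K_def walk_eq_0)
    then show ?thesis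
      using t by (simp add: prod_list_diag_prod K_def walk_diag)
  qed
  have "det ?L / det (mat n n (\<lambda>(i, j). w (i + j))) = det (A * B * C)"
    unfolding H L using carrier M K by (simp add: det_mult[of _ n])
  also have "\<dots> = (\<Sum>k = 0..<Suc n. \<Sum>j = 0..<Suc n. opoly s t 0 j a * opoly s t 0 k c
       * green s t n b k j * (\<Prod>l\<in>{k..<n}. t l))"
    unfolding A_def B_def C_def by (rule det_jac_product) (use t nonzero in auto)
  finally show ?thesis .
qed

section \<open>Specialization to rational functions in three indeterminates\<close>

lemma const3_hom:
  "const3 0 = 0" "const3 1 = 1" "const3 (x + y) = const3 x + const3 y"
  "const3 (x - y) = const3 x - const3 y" "const3 (x * y) = const3 x * const3 y"
  by (simp_all add: const3_def pCons_one flip: to_fract_add to_fract_diff to_fract_mult)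

lemma const3_eq_0_iff: "const3 x = 0 \<longleftrightarrow> x = 0"
  by (simp add: const3_def)

lemma const3_walk: "const3 (moment2 s t n k) = walk (\<lambda>l. const3 (s l)) (\<lambda>l. const3 (t l)) n k"
  by (induction n arbitrary: k) (auto simp: const3_hom)

lemma fpoly_at_eq: "fpoly_at s t r n x = opoly (\<lambda>l. const3 (s l)) (\<lambda>l. const3 (t l)) r n x"
proof -
  let ?ev = "\<lambda>p. poly (map_poly const3 p) x"
  have pCons: "?ev (pCons c p) = const3 c + x * ?ev p" for c p
    by (simp add: map_poly_pCons const3_hom)
  have smult: "?ev (smult c p) = const3 c * ?ev p" for c p
    by (simp add: map_poly_smult const3_hom)
  have "map_poly const3 (p + q) = map_poly const3 p + map_poly const3 q"
    "map_poly const3 (p - q) = map_poly const3 p - map_poly const3 q" for p q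
    by (auto intro!: poly_eqI simp: coeff_map_poly const3_hom)
  then have add: "?ev (p + q) = ?ev p + ?ev q" "?ev (p - q) = ?ev p - ?ev q" for p q
    by simp_all
  show ?thesis
    unfolding fpoly_at_def
  proof (induction n rule: induct_nat_012)
    case 0
    show ?case by (simp add: one_pCons pCons const3_hom)
  next
    case 1
    show ?case by (simp add: pCons const3_hom)
  next
    case (ge2 n)
    then show ?case by (simp add: add pCons smult const3_hom algebra_simps)
  qed
qed

lemma opoly_hom:
  assumes "h 1 = 1" "\<And>x y. h (x + y) = h x + h y" "\<And>x y. h (x - y) = h x - h y"
    "\<And>x y. h (x * y) = h x * h y"
  shows "h (opoly s t r n x) = opoly (\<lambda>l. h (s l)) (\<lambda>l. h (t l)) r n (h x)"
  by (induction n rule: induct_nat_012) (simp_all add: assms)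

lemma opoly_monic:
  fixes s t :: "nat \<Rightarrow> 'a :: comm_ring_1" and r :: nat
  defines "P \<equiv> \<lambda>n. opoly (\<lambda>l. [:s l:]) (\<lambda>l. [:t l:]) r n [:0, 1:]"
  shows "degree (P n) \<le> n \<and> coeff (P n) n = 1"
proof (induction n rule: induct_nat_012)
  case (ge2 n)
  have P: "P (Suc (Suc n)) = pCons 0 (P (Suc n)) + smult (s (Suc n + r)) (P (Suc n))
      - smult (t (n + r)) (P n)"
    by (simp add: P_def algebra_simps)
  have "degree (P (Suc (Suc n))) \<le> Suc (Suc n)"
    unfolding P using ge2
    by (intro degree_diff_le degree_add_le degree_pCons_le[THEN order_trans]
        degree_smult_le[THEN order_trans]) auto
  then show ?case
    using ge2 by (simp add: P coeff_eq_0)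
qed (auto simp: P_def)

text \<open>This makes \<open>det B\<close> cancellable. The value lies in the polynomials in
  \<open>\<alpha>\<close> and \<open>\<beta>\<close>, embedded as constants in
  \<open>\<gamma>\<close>, and there it is monic in \<open>\<beta>\<close>.\<close>

lemma opoly_beta_nonzero: "opoly (\<lambda>l. const3 (s l)) (\<lambda>l. const3 (t l)) r n \<beta> \<noteq> 0"
proof -
  let ?h = "\<lambda>p :: real poly poly. to_fract [:p:]"
  let ?p = "opoly (\<lambda>l. [:[:s l:]:]) (\<lambda>l. [:[:t l:]:]) r n [:0, 1:]"
  have "opoly (\<lambda>l. const3 (s l)) (\<lambda>l. const3 (t l)) r n \<beta> = ?h ?p"
    unfolding const3_def ind_beta_def
    by (rule opoly_hom[symmetric]) (simp_all add: pCons_one flip: to_fract_add to_fract_diff to_fract_mult)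
  moreover have "?p \<noteq> 0"
    using opoly_monic[of "\<lambda>l. [:s l:]" "\<lambda>l. [:t l:]" r n] by auto
  ultimately show ?thesis by simp
qed

theorem theorem5:
  fixes s t :: "nat \<Rightarrow> real" and n :: nat
  assumes "\<And>l. t l \<noteq> 0" and "n > 0"
  shows
    "det (mat n n (\<lambda>(i, j).
         \<alpha> * \<beta> * \<gamma> * const3 (moment s t (i + j))
         + (\<alpha> * \<beta> + \<beta> * \<gamma> + \<gamma> * \<alpha>) * const3 (moment s t (i + j + 1))
         + (\<alpha> + \<beta> + \<gamma>) * const3 (moment s t (i + j + 2))
         + const3 (moment s t (i + j + 3))))
       / det (mat n n (\<lambda>(i, j). const3 (moment s t (i + j))))
     = (\<Sum>j\<in>{0..n}. \<Sum>k\<in>{0..j}.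
          fpoly_at s t 0 j \<alpha> * fpoly_at s t 0 k \<beta> * fpoly_at s t 0 k \<gamma>
          * fpoly_at s t (j + 1) (n - j) \<beta> * (\<Prod>l\<in>{k..<n}. const3 (t l)))
     + (\<Sum>k\<in>{0..n}. \<Sum>j\<in>{0..<k}.
          fpoly_at s t 0 j \<alpha> * fpoly_at s t 0 j \<beta> * fpoly_at s t 0 k \<gamma>
          * fpoly_at s t (k + 1) (n - k) \<beta> * (\<Prod>l\<in>{j..<n}. const3 (t l)))"
proof -
  have nonzero: "opoly (\<lambda>l. const3 (s l)) (\<lambda>l. const3 (t l)) 0 (Suc n) \<beta> \<noteq> 0"
    by (rule opoly_beta_nonzero)
  \<comment> \<open>The square of index pairs is cut into \<open>k \<le> j\<close> and
    \<open>j < k\<close>, the two cases of \<open>green\<close>; the first triangle is then summed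
    with \<open>j\<close> outermost.\<close>
  have split: "(\<Sum>k = 0..<Suc n. \<Sum>j = 0..<Suc n. g k j) =
      (\<Sum>j\<in>{0..n}. \<Sum>k\<in>{0..j}. g k j) + (\<Sum>k\<in>{0..n}. \<Sum>j\<in>{0..<k}. g k j)"
    for g :: "nat \<Rightarrow> nat \<Rightarrow> ratfun3"
  proof -
    have "(\<Sum>k = 0..<Suc n. \<Sum>j = 0..<Suc n. g k j) =
        (\<Sum>k\<in>{0..n}. (\<Sum>j\<in>{k..n}. g k j) + (\<Sum>j\<in>{0..<k}. g k j))"
      unfolding atLeastLessThanSuc_atLeastAtMost
    proof (intro sum.cong refl)
      fix k assume "k \<in> {0..n}"
      then have "{0..n} = {k..n} \<union> {0..<k}" by auto
      then show "(\<Sum>j\<in>{0..n}. g k j) = (\<Sum>j\<in>{k..n}. g k j) + (\<Sum>j\<in>{0..<k}. g k j)"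
        by (auto intro: sum.union_disjoint)
    qed
    also have "\<dots> = (\<Sum>k\<in>{0..n}. \<Sum>j\<in>{k..n}. g k j) + (\<Sum>k\<in>{0..n}. \<Sum>j\<in>{0..<k}. g k j)"
      by (rule sum.distrib)
    also have "(\<Sum>k\<in>{0..n}. \<Sum>j\<in>{k..n}. g k j) = (\<Sum>j\<in>{0..n}. \<Sum>k\<in>{0..j}. g k j)"
      unfolding sum.Sigma[OF finite_atLeastAtMost ballI[OF finite_atLeastAtMost]]
      by (rule sum.reindex_bij_witness[where i = prod.swap and j = prod.swap]) auto
    finally show ?thesis .
  qed
  have t: "const3 (t l) \<noteq> 0" for l
    using assms(1) by (simp add: const3_eq_0_iff)
  show ?thesis
    unfolding moment_def const3_walk fpoly_at_eq det_walk_product[OF t nonzero] split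
  proof (intro arg_cong2[of _ _ _ _ "(+)"] sum.cong refl)
    let ?f = "\<lambda>r n x. opoly (\<lambda>l. const3 (s l)) (\<lambda>l. const3 (t l)) r n x"
    let ?g = "green (\<lambda>l. const3 (s l)) (\<lambda>l. const3 (t l)) n \<beta>"
    fix j k assume "j \<in> {0..n}" "k \<in> {0..j}"
    then show "?f 0 j \<alpha> * ?f 0 k \<gamma> * ?g k j * (\<Prod>l\<in>{k..<n}. const3 (t l)) =
      ?f 0 j \<alpha> * ?f 0 k \<beta> * ?f 0 k \<gamma> * ?f (j + 1) (n - j) \<beta> * (\<Prod>l\<in>{k..<n}. const3 (t l))"
      by (simp add: green_def mult_ac)
  next
    let ?f = "\<lambda>r n x. opoly (\<lambda>l. const3 (s l)) (\<lambda>l. const3 (t l)) r n x"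
    let ?g = "green (\<lambda>l. const3 (s l)) (\<lambda>l. const3 (t l)) n \<beta>"
    fix k j assume k: "k \<in> {0..n}" and j: "j \<in> {0..<k}"
    \<comment> \<open>\<open>green\<close> contributes the factors from \<open>j\<close> to
      \<open>k - 1\<close>, the left kernel vector those from \<open>k\<close> on.\<close>
    then have "(\<Prod>l\<in>{j..<n}. const3 (t l)) =
        (\<Prod>l\<in>{j..<k}. const3 (t l)) * (\<Prod>l\<in>{k..<n}. const3 (t l))"
      by (simp add: prod.atLeastLessThan_concat)
    then show "?f 0 j \<alpha> * ?f 0 k \<gamma> * ?g k j * (\<Prod>l\<in>{k..<n}. const3 (t l)) =
      ?f 0 j \<alpha> * ?f 0 j \<beta> * ?f 0 k \<gamma> * ?f (k + 1) (n - k) \<beta> * (\<Prod>l\<in>{j..<n}. const3 (t l))"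
      using j by (simp add: green_def mult_ac)
  qed
qed

end
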